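(* Assume that the numerical scheme $\{(Y_i,Z_i)\}_{i=0,\dots,N}$ is stable (in the sense of the context), with constants $\rho,c>0$ and terms $\{H_i\}_{i=0,\dots,N-1}$. Denote the one-step discretization errors, for $i=0,\dots,N-1$, by $$\tau_i(Y):=\mathbb E\big[|Y_{t_i}-Y_{i,(Y_{t_{i+1}},\bar Z_{t_{i+1}})}|^2\big],\qquad\tau_i(Z):=\mathbb E\big[|\bar Z_{t_i}-Z_{i,(Y_{t_{i+1}},\bar Z_{t_{i+1}})}|^2h\big].$$ Then there exists a constant $C=C(\rho,T,c)$ such that $$\max_{i=0,\dots,N}\mathbb E\big[|Y_{t_i}-Y_i|^2\big]+\sum_{i=0}^{N-1}\mathbb E\big[|\bar Z_{t_i}-Z_i|^2\big]h$$ $$\le C\Big\{\mathbb E\big[|Y_{t_N}-Y_N|^2\big]+\mathbb E\big[|\bar Z_{t_N}-Z_N|^2\big]h+\sum_{i=0}^{N-1}\Big(\frac{\tau_i(Y)}h+\tau_i(Z)\Big)\Big\}+(1+h)\,\mathcal R^{\mathcal S}(H),$$ where $\mathcal R^{\mathcal S}(H):=\max_{i=0,\dots,N-1}\sum_{j=i}^{N-1}e^{c(j-i)h}\,\mathbb E[H_j]$ is the stability remainder.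
   Context: Setting. Fix $T>0$ and a $d$-dimensional Brownian motion $W$ on $[0,T]$ with augmented natural filtration $(\mathcal F_t)$. For $N\in\mathbb N$ let $h=T/N$, $t_i=ih$, $i=0,\dots,N$. Let $(X,Y,Z)$ be the solution on $[0,T]$ of $$X_s=x+\int_0^sb(r,X_r)dr+\int_0^s\sigma(r,X_r)dW_r,\qquad Y_s=g(X_T)+\int_s^Tf(r,X_r,Y_r,Z_r)dr-\int_s^TZ_rdW_r,$$ under the following assumptions: $b,\sigma$ are $1/2$-Hölder in time, Lipschitz in space, with $b(\cdot,0),\sigma(\cdot,0)$ bounded; $g$ is Lipschitz; $f$ is continuous and, for some $m\ge1$ and positive constants $L,L_t,L_x,L_y,L_z$ and all arguments, $|f(t,x,y,z)|\le L+L_x|x|+L_y|y|^m+L_z\|z\|$, $\langle y'-y,f(t,x,y',z)-f(t,x,y,z)\rangle\le L_y|y'-y|^2$, $|f(t,x,y,z)-f(t',x',y,z')|\le L_t|t-t'|^{1/2}+L_x|x-x'|+L_z\|z-z'\|$. Set $\bar Z_{t_i}=\frac1h\mathbb E[\int_{t_i}^{t_{i+1}}Z_sds\mid\mathcal F_{t_i}]$ for $i<N$ and $\bar Z_{t_N}=Z_T$, where $Z_T=\nabla g(X_T)\sigma(T,X_T)$ if $g\in C^1$ and in general $Z_T=G\,\sigma(T,X_T)$ for a bounded $\mathcal F_T$-measurable $G$; $\bar Z_{t_i}\in L^2$ for all $i$. A family $\{X_i\}_{i=0,\dots,N}$ approximating $X$ on the grid is given, and $\mathcal F_i:=\sigma(X_j,\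 j=0,\dots,i)$. Abstract scheme: a discretization scheme generates, backward in time, random variables $\{(Y_i,Z_i)\}_{i=0,\dots,N}$ approximating $\{(Y_{t_i},\bar Z_{t_i})\}$ via operators $\Phi_i:L^2(\mathcal F_{i+1})\times L^2(\mathcal F_{i+1})\to L^2(\mathcal F_i)\times L^2(\mathcal F_i)$, $i=N-1,\dots,0$: one starts from an initial approximation $(Y_N,Z_N)$ and sets $(Y_i,Z_i):=\Phi_i(Y_{i+1},Z_{i+1})$. For an $\mathcal F_{t_{i+1}}$-measurable input $(\mathcal Y,\mathcal Z)$ the output of $\Phi_i(\mathcal Y,\mathcal Z)$ is denoted $(Y_{i,(\mathcal Y,\mathcal Z)},Z_{i,(\mathcal Y,\mathcal Z)})$ (in particular $\Phi_i$ is also applied to $(Y_{t_{i+1}},\bar Z_{t_{i+1}})$); thus $(Y_i,Z_i)=(Y_{i,(Y_{i+1},Z_{i+1})},Z_{i,(Y_{i+1},Z_{i+1})})$. Stability: the scheme is stable if for some $\rho>0$ there exists a constant $c>0$ such that for $i=0,\dots,N-1$ $$\mathbb E\big[|Y_{i,(Y_{t_{i+1}},\bar Z_{t_{i+1}})}-Y_{i,(Y_{i+1},Z_{i+1})}|^2\big]+\rho\,\mathbb E\big[|Z_{i,(Y_{t_{i+1}},\bar Z_{t_{i+1}})}-Z_{i,(Y_{i+1},Z_{i+1})}|^2\big]h$$ $$\le(1+ch)\Big(\mathbb E\big[|Y_{t_{i+1}}-Y_{i+1}|^2\big]+\frac\rho4\mathbb E\big[|\bar Z_{t_{i+1}}-Z_{i+1}|^2\big]h\Big)+\mathbb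 E[H_i],$$ where $H_i\in L^1(\mathcal F_i)$, and moreover $\mathcal R^{\mathcal S}(H)=\max_{0\le i\le N-1}\sum_{j=i}^{N-1}e^{c(j-i)h}\mathbb E[H_j]\to0$ as $h\to0$. Convention on constants: $c>0$ is a generic constant, always independent of $h$ and $N$, which may depend on the data of the problem and may change from one occurrence to the next.
   Formalization: The term (1+h)R^S(H) is replaced by K(1+h)R^S(H) with a constant K>0 depending, like C, on ρ, T, c (sample space and dimensions fixed): with K=1 the bound fails, as a stable scheme can turn one E[H_1] into both a Y-error and a further Z-error of size E[H_1]/ρ. *)

theory Defs
  imports "HOL-Probability.Probability"
begin

section \<open>Filtrations, Brownian motion, square-integrable random variables\<close>

text \<open>The augmented natural filtration. Only the sigma-algebra of the measure object is used.\<close>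

definition aug_filtration ::
  "'w measure \<Rightarrow> (real \<Rightarrow> 'w \<Rightarrow> 'e::topological_space) \<Rightarrow> real \<Rightarrow> 'w measure" where
  "aug_filtration M W t =
     sigma (space M) ((\<Union>s\<in>{0..t}. {W s -` A \<inter> space M | A. A \<in> sets borel}) \<union> null_sets M)"

definition brownian_motion :: "'w measure \<Rightarrow> real \<Rightarrow> (real \<Rightarrow> 'w \<Rightarrow> real^'d) \<Rightarrow> bool" where
  "brownian_motion M T W \<longleftrightarrow>
     (\<forall>t\<in>{0..T}. W t \<in> borel_measurable M) \<and>
     (AE \<omega> in M. W 0 \<omega> = 0) \<and>
     (AE \<omega> in M. continuous_on {0..T} (\<lambda>t. W t \<omega>)) \<and>
     (\<forall>s t. 0 \<le> s \<and> s < t \<and> t \<le> T \<longrightarrow>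
        prob_space.indep_set M (sets (aug_filtration M W s))
          (sets (vimage_algebra (space M) (\<lambda>\<omega>. W t \<omega> - W s \<omega>) borel)) \<and>
        prob_space.indep_vars M (\<lambda>_. borel) (\<lambda>j \<omega>. (W t \<omega> - W s \<omega>) $ j) UNIV \<and>
        (\<forall>j. distributed M lborel (\<lambda>\<omega>. (W t \<omega> - W s \<omega>) $ j) (normal_density 0 (sqrt (t - s)))))"

definition progressive ::
  "'w measure \<Rightarrow> (real \<Rightarrow> 'w measure) \<Rightarrow> real \<Rightarrow> (real \<Rightarrow> 'w \<Rightarrow> 'e::topological_space) \<Rightarrow> bool" where
  "progressive M F T U \<longleftrightarrow>
     (\<forall>t\<in>{0..T}. (\<lambda>(s, \<omega>). U s \<omega>) \<in> borel_measurable (restrict_space borel {0..t} \<Otimes>\<^sub>M F t))"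

text \<open>Square-integrable random variables that are measurable for the sigma-algebra of \<open>G\<close>.
  Elements are functions, not classes modulo null sets.\<close>

definition L2 :: "'w measure \<Rightarrow> 'w measure \<Rightarrow> ('w \<Rightarrow> 'e::real_normed_vector) set" where
  "L2 M G = {V. V \<in> borel_measurable G \<and> integrable M (\<lambda>\<omega>. (norm (V \<omega>))\<^sup>2)}"

text \<open>\<open>S2\<close>: continuous progressive processes with square-integrable supremum, the latter being
  expressed by an integrable bound. \<open>H2\<close>: progressive processes with
  \<open>E \<integral>\<^sub>0\<^sup>T |U\<^sub>r|\<^sup>2 dr < \<infinity>\<close>.\<close>

definition S2 ::
  "'w measure \<Rightarrow> (real \<Rightarrow> 'w measure) \<Rightarrow> real \<Rightarrow> (real \<Rightarrow> 'w \<Rightarrow> 'e::real_normed_vector) set" where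
  "S2 M F T = {U. progressive M F T U \<and>
     (AE \<omega> in M. continuous_on {0..T} (\<lambda>t. U t \<omega>)) \<and>
     (\<exists>B :: 'w \<Rightarrow> real. integrable M B \<and> (AE \<omega> in M. \<forall>t\<in>{0..T}. (norm (U t \<omega>))\<^sup>2 \<le> B \<omega>))}"

definition H2 ::
  "'w measure \<Rightarrow> (real \<Rightarrow> 'w measure) \<Rightarrow> real \<Rightarrow> (real \<Rightarrow> 'w \<Rightarrow> 'e::real_normed_vector) set" where
  "H2 M F T = {U. progressive M F T U \<and>
     (\<integral>\<^sup>+\<omega>. (\<integral>\<^sup>+r\<in>{0..T}. ennreal ((norm (U r \<omega>))\<^sup>2) \<partial>lborel) \<partial>M) < \<infinity>}"

section \<open>The Ito integral of a matrix-valued integrand\<close>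

text \<open>The norm on \<open>real^'d^'m\<close> is the Frobenius norm. A simple process takes the value \<open>\<xi> j\<close> on
  the interval \<open>]s j, s (j+1)]\<close>, for \<open>j < n\<close>.\<close>

definition simple_process ::
  "'w measure \<Rightarrow> (real \<Rightarrow> 'w measure) \<Rightarrow> real \<Rightarrow> nat \<Rightarrow> (nat \<Rightarrow> real) \<Rightarrow> (nat \<Rightarrow> 'w \<Rightarrow> real^'d^'m) \<Rightarrow> bool"
  where
  "simple_process M F T n s \<xi> \<longleftrightarrow>
     s 0 = 0 \<and> s n = T \<and>
     (\<forall>j<n. s j < s (Suc j) \<and> \<xi> j \<in> borel_measurable (F (s j)) \<and>
        (\<exists>B. \<forall>\<omega>\<in>space M. norm (\<xi> j \<omega>) \<le> B))"

definition simple_value ::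
  "nat \<Rightarrow> (nat \<Rightarrow> real) \<Rightarrow> (nat \<Rightarrow> 'w \<Rightarrow> real^'d^'m) \<Rightarrow> real \<Rightarrow> 'w \<Rightarrow> real^'d^'m" where
  "simple_value n s \<xi> r \<omega> = (\<Sum>j<n. indicator {s j<..s (Suc j)} r *\<^sub>R \<xi> j \<omega>)"

definition simple_integral ::
  "(real \<Rightarrow> 'w \<Rightarrow> real^'d) \<Rightarrow> nat \<Rightarrow> (nat \<Rightarrow> real) \<Rightarrow> (nat \<Rightarrow> 'w \<Rightarrow> real^'d^'m) \<Rightarrow> real \<Rightarrow> 'w \<Rightarrow> real^'m"
  where
  "simple_integral W n s \<xi> t \<omega> =
     (\<Sum>j<n. \<xi> j \<omega> *v (W (min (s (Suc j)) t) \<omega> - W (min (s j) t) \<omega>))"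

text \<open>\<open>I t\<close> is a version of \<open>\<integral>\<^sub>0\<^sup>t U dW\<close> for every \<open>t \<in> [0,T]\<close>: the \<open>L\<^sup>2\<close> limit of the integrals of
  simple processes that approximate \<open>U\<close> in \<open>L\<^sup>2(dt \<otimes> dP)\<close>.\<close>

definition has_ito_integral ::
  "'w measure \<Rightarrow> (real \<Rightarrow> 'w measure) \<Rightarrow> (real \<Rightarrow> 'w \<Rightarrow> real^'d) \<Rightarrow> real
    \<Rightarrow> (real \<Rightarrow> 'w \<Rightarrow> real^'d^'m) \<Rightarrow> (real \<Rightarrow> 'w \<Rightarrow> real^'m) \<Rightarrow> bool" where
  "has_ito_integral M F W T U I \<longleftrightarrow>
     U \<in> H2 M F T \<and> (\<forall>t\<in>{0..T}. I t \<in> borel_measurable (F t)) \<and>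
     (\<exists>n s \<xi>. (\<forall>k. simple_process M F T (n k) (s k) (\<xi> k)) \<and>
        (\<lambda>k. \<integral>\<^sup>+\<omega>. (\<integral>\<^sup>+r\<in>{0..T}.
            ennreal ((norm (U r \<omega> - simple_value (n k) (s k) (\<xi> k) r \<omega>))\<^sup>2) \<partial>lborel) \<partial>M)
          \<longlonglongrightarrow> 0 \<and>
        (\<forall>t\<in>{0..T}.
          (\<lambda>k. \<integral>\<^sup>+\<omega>. ennreal ((norm (I t \<omega> - simple_integral W (n k) (s k) (\<xi> k) t \<omega>))\<^sup>2) \<partial>M)
            \<longlonglongrightarrow> 0))"

section \<open>The forward-backward SDE\<close>

definition fsde_coeffs ::
  "real \<Rightarrow> (real \<Rightarrow> real^'n \<Rightarrow> real^'n) \<Rightarrow> (real \<Rightarrow> real^'n \<Rightarrow> real^'d^'n) \<Rightarrow> bool" where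
  "fsde_coeffs T b \<sigma> \<longleftrightarrow>
     (\<exists>K. \<forall>t\<in>{0..T}. \<forall>t'\<in>{0..T}. \<forall>x x'.
        norm (b t x - b t' x) \<le> K * sqrt \<bar>t - t'\<bar> \<and>
        norm (\<sigma> t x - \<sigma> t' x) \<le> K * sqrt \<bar>t - t'\<bar> \<and>
        norm (b t x - b t x') \<le> K * norm (x - x') \<and>
        norm (\<sigma> t x - \<sigma> t x') \<le> K * norm (x - x') \<and>
        norm (b t 0) \<le> K \<and> norm (\<sigma> t 0) \<le> K)"

definition bsde_coeffs ::
  "real \<Rightarrow> (real \<Rightarrow> real^'n \<Rightarrow> real^'k \<Rightarrow> real^'d^'k \<Rightarrow> real^'k) \<Rightarrow> (real^'n \<Rightarrow> real^'k) \<Rightarrow> bool" where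
  "bsde_coeffs T f g \<longleftrightarrow>
     (\<exists>K. \<forall>x x'. norm (g x - g x') \<le> K * norm (x - x')) \<and>
     continuous_on ({0..T} \<times> UNIV) (\<lambda>(t, x, y, z). f t x y z) \<and>
     (\<exists>m L Lt Lx Ly Lz :: real. 1 \<le> m \<and> 0 < L \<and> 0 < Lt \<and> 0 < Lx \<and> 0 < Ly \<and> 0 < Lz \<and>
        (\<forall>t\<in>{0..T}. \<forall>t'\<in>{0..T}. \<forall>x x' y y' z z'.
           norm (f t x y z) \<le> L + Lx * norm x + Ly * norm y powr m + Lz * norm z \<and>
           (y' - y) \<bullet> (f t x y' z - f t x y z) \<le> Ly * (norm (y' - y))\<^sup>2 \<and>
           norm (f t x y z - f t' x' y z')
             \<le> Lt * sqrt \<bar>t - t'\<bar> + Lx * norm (x - x') + Lz * norm (z - z')))"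

text \<open>The Jacobian of \<open>g\<close>, and \<open>g \<in> C\<^sup>1\<close>.\<close>

definition jacobian :: "(real^'n \<Rightarrow> real^'k) \<Rightarrow> real^'n \<Rightarrow> real^'n^'k" where
  "jacobian g x = matrix (frechet_derivative g (at x))"

definition C1 :: "(real^'n \<Rightarrow> real^'k) \<Rightarrow> bool" where
  "C1 g \<longleftrightarrow> (\<forall>x. g differentiable (at x)) \<and> continuous_on UNIV (jacobian g)"

text \<open>The conditional mean \<open>h\<^sup>-\<^sup>1 E[\<integral> Z\<^sub>s ds | \<F>\<^bsub>t\<^sub>i\<^esub>]\<close> over the \<open>i\<close>-th time step (taken entrywise), and \<open>Z\<^sub>T\<close>
  at the last grid point; here \<open>h = T/N\<close>.\<close>

definition Zbar ::
  "'w measure \<Rightarrow> (real \<Rightarrow> 'w measure) \<Rightarrow> real \<Rightarrow> (real \<Rightarrow> 'w \<Rightarrow> real^'d^'k) \<Rightarrow> nat \<Rightarrow> nat \<Rightarrow> 'w \<Rightarrow> real^'d^'k"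
  where
  "Zbar M F T Z N i =
     (let h = T / real N in
      if i < N then
        (\<lambda>\<omega>. \<chi> p q. (1 / h) *
           real_cond_exp M (F (real i * h))
             (\<lambda>\<omega>'. LINT s:{real i * h..real (Suc i) * h}|lborel. Z s \<omega>' $ p $ q) \<omega>)
      else Z T)"

text \<open>\<open>Z\<close> is only determined up to \<open>dt \<otimes> dP\<close>-null sets by the equation; its value at time \<open>T\<close> is
  fixed separately by the two axioms on \<open>Z T\<close>.\<close>

locale fbsde = prob_space M
  for M :: "'w measure" and T :: real and W :: "real \<Rightarrow> 'w \<Rightarrow> real^'d"
    and b :: "real \<Rightarrow> real^'n \<Rightarrow> real^'n" and \<sigma> :: "real \<Rightarrow> real^'n \<Rightarrow> real^'d^'n"
    and f :: "real \<Rightarrow> real^'n \<Rightarrow> real^'k \<Rightarrow> real^'d^'k \<Rightarrow> real^'k" and g :: "real^'n \<Rightarrow> real^'k"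
    and x :: "real^'n"
    and X :: "real \<Rightarrow> 'w \<Rightarrow> real^'n" and Y :: "real \<Rightarrow> 'w \<Rightarrow> real^'k" and Z :: "real \<Rightarrow> 'w \<Rightarrow> real^'d^'k" +
  assumes T_pos: "0 < T"
    and brownian: "brownian_motion M T W"
    and forward_coeffs: "fsde_coeffs T b \<sigma>"
    and backward_coeffs: "bsde_coeffs T f g"
    and X_S2: "X \<in> S2 M (aug_filtration M W) T"
    and Y_S2: "Y \<in> S2 M (aug_filtration M W) T"
    and Z_H2: "Z \<in> H2 M (aug_filtration M W) T"
    and forward_eq: "\<exists>I. has_ito_integral M (aug_filtration M W) W T (\<lambda>r \<omega>. \<sigma> r (X r \<omega>)) I \<and>
      (\<forall>s\<in>{0..T}. AE \<omega> in M. X s \<omega> = x + (LINT r:{0..s}|lborel. b r (X r \<omega>)) + I s \<omega>)"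
    and backward_eq: "\<exists>J. has_ito_integral M (aug_filtration M W) W T Z J \<and>
      (\<forall>s\<in>{0..T}. AE \<omega> in M.
         Y s \<omega> = g (X T \<omega>) + (LINT r:{s..T}|lborel. f r (X r \<omega>) (Y r \<omega>) (Z r \<omega>)) - (J T \<omega> - J s \<omega>))"
    and Z_terminal: "\<exists>G :: 'w \<Rightarrow> real^'n^'k. G \<in> borel_measurable (aug_filtration M W T) \<and>
      (\<exists>B. \<forall>\<omega>\<in>space M. norm (G \<omega>) \<le> B) \<and> (AE \<omega> in M. Z T \<omega> = G \<omega> ** \<sigma> T (X T \<omega>))"
    and Z_terminal_C1: "C1 g \<Longrightarrow> AE \<omega> in M. Z T \<omega> = jacobian g (X T \<omega>) ** \<sigma> T (X T \<omega>)"
    and Zbar_L2: "\<And>N i. 1 \<le> N \<Longrightarrow> i \<le> N \<Longrightarrow> Zbar M (aug_filtration M W) T Z N i \<in> L2 M M"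

section \<open>Discretization schemes\<close>

text \<open>\<open>grid_filtration M Xg N i\<close> is \<open>\<sigma>(X\<^sub>j, j = 0,\<dots>,i)\<close> for the approximation \<open>Xg N\<close> with \<open>N\<close> steps.\<close>

definition grid_filtration ::
  "'w measure \<Rightarrow> (nat \<Rightarrow> nat \<Rightarrow> 'w \<Rightarrow> real^'n) \<Rightarrow> nat \<Rightarrow> nat \<Rightarrow> 'w measure" where
  "grid_filtration M Xg N i =
     sigma (space M) (\<Union>j\<in>{..i}. {Xg N j -` A \<inter> space M | A. A \<in> sets borel})"

text \<open>A family of schemes, indexed by the number \<open>N\<close> of steps. The operator \<open>\<Phi> N i\<close> acts on
  \<open>L\<^sup>2(\<F>\<^sub>i\<^sub>+\<^sub>1)\<close> and also on \<open>L\<^sup>2(\<F>\<^bsub>t\<^sub>i\<^sub>+\<^sub>1\<^esub>)\<close>, which contains the exact solution. Inputs of the second kind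
  need not give \<open>\<F>\<^sub>i\<close>-measurable outputs. As \<open>L2\<close> consists of functions, compatibility with
  almost sure equality is stated explicitly.\<close>

locale backward_scheme =
  fixes M :: "'w measure" and T :: real and F :: "real \<Rightarrow> 'w measure"
    and Xg :: "nat \<Rightarrow> nat \<Rightarrow> 'w \<Rightarrow> real^'n"
    and \<Phi> :: "nat \<Rightarrow> nat \<Rightarrow> ('w \<Rightarrow> real^'k) \<times> ('w \<Rightarrow> real^'d^'k) \<Rightarrow> ('w \<Rightarrow> real^'k) \<times> ('w \<Rightarrow> real^'d^'k)"
    and Yh :: "nat \<Rightarrow> nat \<Rightarrow> 'w \<Rightarrow> real^'k" and Zh :: "nat \<Rightarrow> nat \<Rightarrow> 'w \<Rightarrow> real^'d^'k"
  assumes grid_measurable: "\<And>N j. 1 \<le> N \<Longrightarrow> j \<le> N \<Longrightarrow> Xg N j \<in> borel_measurable M"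
    and op_grid: "\<And>N i u. 1 \<le> N \<Longrightarrow> i < N \<Longrightarrow>
      u \<in> L2 M (grid_filtration M Xg N (Suc i)) \<times> L2 M (grid_filtration M Xg N (Suc i)) \<Longrightarrow>
      \<Phi> N i u \<in> L2 M (grid_filtration M Xg N i) \<times> L2 M (grid_filtration M Xg N i)"
    and op_full: "\<And>N i u. 1 \<le> N \<Longrightarrow> i < N \<Longrightarrow>
      u \<in> L2 M (F (real (Suc i) * (T / real N))) \<times> L2 M (F (real (Suc i) * (T / real N))) \<Longrightarrow>
      \<Phi> N i u \<in> L2 M M \<times> L2 M M"
    and op_AE_cong: "\<And>N i G G' u v. 1 \<le> N \<Longrightarrow> i < N \<Longrightarrow>
      G \<in> {grid_filtration M Xg N (Suc i), F (real (Suc i) * (T / real N))} \<Longrightarrow>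
      G' \<in> {grid_filtration M Xg N (Suc i), F (real (Suc i) * (T / real N))} \<Longrightarrow>
      u \<in> L2 M G \<times> L2 M G \<Longrightarrow> v \<in> L2 M G' \<times> L2 M G' \<Longrightarrow>
      (AE \<omega> in M. fst u \<omega> = fst v \<omega> \<and> snd u \<omega> = snd v \<omega>) \<Longrightarrow>
      AE \<omega> in M. fst (\<Phi> N i u) \<omega> = fst (\<Phi> N i v) \<omega> \<and> snd (\<Phi> N i u) \<omega> = snd (\<Phi> N i v) \<omega>"
    and terminal: "\<And>N. 1 \<le> N \<Longrightarrow>
      (Yh N N, Zh N N) \<in> L2 M (grid_filtration M Xg N N) \<times> L2 M (grid_filtration M Xg N N)"
    and recursion: "\<And>N i. 1 \<le> N \<Longrightarrow> i < N \<Longrightarrow> (Yh N i, Zh N i) = \<Phi> N i (Yh N (Suc i), Zh N (Suc i))"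

definition msq :: "'w measure \<Rightarrow> ('w \<Rightarrow> 'e::real_normed_vector) \<Rightarrow> real" where
  "msq M V = (LINT \<omega>|M. (norm (V \<omega>))\<^sup>2)"

text \<open>One step of the scheme started from the exact values \<open>(Y\<^bsub>t\<^sub>i\<^sub>+\<^sub>1\<^esub>, Zbar\<^bsub>t\<^sub>i\<^sub>+\<^sub>1\<^esub>)\<close>.\<close>

definition exact_step ::
  "'w measure \<Rightarrow> (real \<Rightarrow> 'w measure) \<Rightarrow> real \<Rightarrow> (real \<Rightarrow> 'w \<Rightarrow> real^'k) \<Rightarrow> (real \<Rightarrow> 'w \<Rightarrow> real^'d^'k)
    \<Rightarrow> (nat \<Rightarrow> nat \<Rightarrow> ('w \<Rightarrow> real^'k) \<times> ('w \<Rightarrow> real^'d^'k) \<Rightarrow> ('w \<Rightarrow> real^'k) \<times> ('w \<Rightarrow> real^'d^'k))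
    \<Rightarrow> nat \<Rightarrow> nat \<Rightarrow> ('w \<Rightarrow> real^'k) \<times> ('w \<Rightarrow> real^'d^'k)" where
  "exact_step M F T Y Z \<Phi> N i =
     \<Phi> N i (Y (real (Suc i) * (T / real N)), Zbar M F T Z N (Suc i))"

definition err_Y ::
  "'w measure \<Rightarrow> real \<Rightarrow> (real \<Rightarrow> 'w \<Rightarrow> real^'k) \<Rightarrow> (nat \<Rightarrow> nat \<Rightarrow> 'w \<Rightarrow> real^'k) \<Rightarrow> nat \<Rightarrow> nat \<Rightarrow> real" where
  "err_Y M T Y Yh N i = msq M (\<lambda>\<omega>. Y (real i * (T / real N)) \<omega> - Yh N i \<omega>)"

definition err_Z ::
  "'w measure \<Rightarrow> (real \<Rightarrow> 'w measure) \<Rightarrow> real \<Rightarrow> (real \<Rightarrow> 'w \<Rightarrow> real^'d^'k)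
    \<Rightarrow> (nat \<Rightarrow> nat \<Rightarrow> 'w \<Rightarrow> real^'d^'k) \<Rightarrow> nat \<Rightarrow> nat \<Rightarrow> real" where
  "err_Z M F T Z Zh N i = msq M (\<lambda>\<omega>. Zbar M F T Z N i \<omega> - Zh N i \<omega>)"

definition tau_Y ::
  "'w measure \<Rightarrow> (real \<Rightarrow> 'w measure) \<Rightarrow> real \<Rightarrow> (real \<Rightarrow> 'w \<Rightarrow> real^'k) \<Rightarrow> (real \<Rightarrow> 'w \<Rightarrow> real^'d^'k)
    \<Rightarrow> (nat \<Rightarrow> nat \<Rightarrow> ('w \<Rightarrow> real^'k) \<times> ('w \<Rightarrow> real^'d^'k) \<Rightarrow> ('w \<Rightarrow> real^'k) \<times> ('w \<Rightarrow> real^'d^'k))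
    \<Rightarrow> nat \<Rightarrow> nat \<Rightarrow> real" where
  "tau_Y M F T Y Z \<Phi> N i =
     msq M (\<lambda>\<omega>. Y (real i * (T / real N)) \<omega> - fst (exact_step M F T Y Z \<Phi> N i) \<omega>)"

definition tau_Z ::
  "'w measure \<Rightarrow> (real \<Rightarrow> 'w measure) \<Rightarrow> real \<Rightarrow> (real \<Rightarrow> 'w \<Rightarrow> real^'k) \<Rightarrow> (real \<Rightarrow> 'w \<Rightarrow> real^'d^'k)
    \<Rightarrow> (nat \<Rightarrow> nat \<Rightarrow> ('w \<Rightarrow> real^'k) \<times> ('w \<Rightarrow> real^'d^'k) \<Rightarrow> ('w \<Rightarrow> real^'k) \<times> ('w \<Rightarrow> real^'d^'k))
    \<Rightarrow> nat \<Rightarrow> nat \<Rightarrow> real" where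
  "tau_Z M F T Y Z \<Phi> N i =
     msq M (\<lambda>\<omega>. Zbar M F T Z N i \<omega> - snd (exact_step M F T Y Z \<Phi> N i) \<omega>) * (T / real N)"

text \<open>The terms \<open>H\<close> carry no sign condition, and the weight of the \<open>Z\<close>-error in the stability inequality
  is \<open>\<rho>\<close>, whereas it is 1 in the global error. An operator that creates a \<open>Z\<close>-error at the last
  backward step \<open>i = 0\<close> only, with \<open>\<rho> E|Z\<^sub>0|\<^sup>2 h = E[H\<^sub>0]\<close>, adds \<open>E[H\<^sub>0] / \<rho>\<close> to the global error but only
  \<open>E[H\<^sub>0]\<close> to the remainder. A global error bound therefore needs a constant factor in front of
  the remainder.\<close>

definition stability_remainder ::
  "'w measure \<Rightarrow> real \<Rightarrow> real \<Rightarrow> (nat \<Rightarrow> nat \<Rightarrow> 'w \<Rightarrow> real) \<Rightarrow> nat \<Rightarrow> real" where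
  "stability_remainder M T c H N =
     Max ((\<lambda>i. \<Sum>j=i..<N. exp (c * real (j - i) * (T / real N)) * (LINT \<omega>|M. H N j \<omega>)) ` {0..<N})"

definition stable_scheme ::
  "'w measure \<Rightarrow> (real \<Rightarrow> 'w measure) \<Rightarrow> real \<Rightarrow> (real \<Rightarrow> 'w \<Rightarrow> real^'k) \<Rightarrow> (real \<Rightarrow> 'w \<Rightarrow> real^'d^'k)
    \<Rightarrow> (nat \<Rightarrow> nat \<Rightarrow> 'w \<Rightarrow> real^'n)
    \<Rightarrow> (nat \<Rightarrow> nat \<Rightarrow> ('w \<Rightarrow> real^'k) \<times> ('w \<Rightarrow> real^'d^'k) \<Rightarrow> ('w \<Rightarrow> real^'k) \<times> ('w \<Rightarrow> real^'d^'k))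
    \<Rightarrow> (nat \<Rightarrow> nat \<Rightarrow> 'w \<Rightarrow> real^'k) \<Rightarrow> (nat \<Rightarrow> nat \<Rightarrow> 'w \<Rightarrow> real^'d^'k)
    \<Rightarrow> real \<Rightarrow> real \<Rightarrow> (nat \<Rightarrow> nat \<Rightarrow> 'w \<Rightarrow> real) \<Rightarrow> bool" where
  "stable_scheme M F T Y Z Xg \<Phi> Yh Zh \<rho> c H \<longleftrightarrow>
     (\<forall>N\<ge>1. \<forall>i<N.
        H N i \<in> borel_measurable (grid_filtration M Xg N i) \<and> integrable M (H N i) \<and>
        msq M (\<lambda>\<omega>. fst (exact_step M F T Y Z \<Phi> N i) \<omega>
                     - fst (\<Phi> N i (Yh N (Suc i), Zh N (Suc i))) \<omega>)
          + \<rho> * msq M (\<lambda>\<omega>. snd (exact_step M F T Y Z \<Phi> N i) \<omega>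
                     - snd (\<Phi> N i (Yh N (Suc i), Zh N (Suc i))) \<omega>) * (T / real N)
        \<le> (1 + c * (T / real N)) *
            (err_Y M T Y Yh N (Suc i) + \<rho> / 4 * err_Z M F T Z Zh N (Suc i) * (T / real N))
          + (LINT \<omega>|M. H N i \<omega>)) \<and>
     (stability_remainder M T c H \<longlonglongrightarrow> 0)"

end

theory Submission
  imports Defs
begin

text \<open>
  The estimate is a backward discrete Gronwall argument. One exact step started from
  \<open>(Y\<^bsub>t\<^sub>i\<^sub>+\<^sub>1\<^esub>, Zbar\<^bsub>t\<^sub>i\<^sub>+\<^sub>1\<^esub>)\<close> is an intermediate value between the exact solution and the scheme at time \<open>t\<^sub>i\<close>:
  its distance to the former is the one-step error \<open>\<tau>\<^sub>i\<close>, its distance to the latter is controlled by stability.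
  Write \<open>a\<^sub>i\<close> and \<open>z\<^sub>i\<close> for the mean square errors of \<open>Y\<close> and \<open>Z\<close>, and \<open>\<eta>\<^sub>i = E[H\<^sub>i]\<close>. Young's
  inequality (\<open>msq_triangle\<close>), with parameter \<open>h\<close> for \<open>Y\<close> and \<open>1\<close> for \<open>Z\<close>, gives
  \<open>a\<^sub>i + \<rho>/2 z\<^sub>i h \<le> (1 + h) (1 + c h) (a\<^sub>i\<^sub>+\<^sub>1 + \<rho>/4 z\<^sub>i\<^sub>+\<^sub>1 h) + (1 + h) \<eta>\<^sub>i + \<theta>\<^sub>i\<close>,
  where \<open>\<theta>\<^sub>i\<close> is at most a constant times \<open>\<tau>\<^sub>i(Y)/h + \<tau>\<^sub>i(Z)\<close>. The quantity \<open>A\<^sub>i = a\<^sub>i + \<rho>/4 z\<^sub>i h\<close> thus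
  propagates with a factor \<open>1 + O(h)\<close>, and the remaining \<open>\<rho>/4 z\<^sub>i h\<close> on the left is summed up along the
  way; so \<open>max a\<^sub>i\<close> and \<open>\<Sum> z\<^sub>i h\<close> are bounded by the same right-hand side.

  The delicate point is that the terms \<open>\<eta>\<^sub>i\<close> carry no sign. Only the tail sums
  \<open>S\<^sub>k = \<Sum>\<^sub>j\<^sub>\<ge>\<^sub>k e\<^bsup>c(j-k)h\<^esup> \<eta>\<^sub>j\<close> are bounded above, by the stability remainder, whereas the recursion,
  with \<open>1 + c h \<le> e\<^bsup>ch\<^esup>\<close>, grows with the factor \<open>(1 + h) e\<^bsup>ch\<^esup>\<close> rather than \<open>e\<^bsup>ch\<^esup>\<close>. Therefore \<open>backward_gronwall\<close> carries \<open>S\<^sub>k\<close> through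
  the induction as a whole; the mismatch of the two rates costs \<open>h (1 + h) e\<^bsup>ch\<^esup> S\<^sub>k\<^sub>+\<^sub>1\<close> per step, that
  is, a bounded multiple of the remainder in total. The remainder may even be negative, but stability
  at the last step gives \<open>\<eta>\<^bsub>N-1\<^esub> \<ge> - (1 + c h) A\<^sub>N\<close>, so its negative part is absorbed by the terminal
  error. \<open>stable_recursion_bound\<close> collects these steps with explicit constants that depend on
  \<open>\<rho>\<close>, \<open>T\<close> and \<open>c\<close> only.

  Young's inequality for mean squares needs square integrability of the exact solution, of the
  exact step and of the scheme. The exact step has it because the exact solution is adapted to the
  Brownian filtration, on which the operators act.
\<close>

section \<open>Splitting mean square errors\<close>

lemma norm_add_sq_le:
  fixes a b :: "'e::real_inner"
  assumes "0 < \<epsilon>"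
  shows "(norm (a + b))\<^sup>2 \<le> (1 + \<epsilon>) * (norm a)\<^sup>2 + (1 + 1 / \<epsilon>) * (norm b)\<^sup>2"
proof -
  have "0 \<le> (norm (\<epsilon> *\<^sub>R a - b))\<^sup>2 / \<epsilon>"
    using assms by simp
  also have "\<dots> = \<epsilon> * (norm a)\<^sup>2 + (norm b)\<^sup>2 / \<epsilon> - 2 * (a \<bullet> b)"
    using assms
    by (simp add: power2_norm_eq_inner inner_diff_left inner_diff_right inner_commute field_simps)
  finally show ?thesis
    by (simp add: power2_norm_eq_inner inner_add_left inner_add_right inner_commute algebra_simps)
qed

lemma L2_diff:
  fixes U V :: "'w \<Rightarrow> 'e::euclidean_space"
  assumes U: "U \<in> L2 M M" and V: "V \<in> L2 M M"
  shows "(\<lambda>\<omega>. U \<omega> - V \<omega>) \<in> L2 M M"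
proof -
  have meas[measurable]: "U \<in> borel_measurable M" "V \<in> borel_measurable M"
    using U V by (auto simp: L2_def)
  have "integrable M (\<lambda>\<omega>. 2 * (norm (U \<omega>))\<^sup>2 + 2 * (norm (V \<omega>))\<^sup>2)"
    using U V by (auto simp: L2_def)
  then have "integrable M (\<lambda>\<omega>. (norm (U \<omega> - V \<omega>))\<^sup>2)"
  proof (rule Bochner_Integration.integrable_bound)
    show "AE \<omega> in M. norm ((norm (U \<omega> - V \<omega>))\<^sup>2) \<le> norm (2 * (norm (U \<omega>))\<^sup>2 + 2 * (norm (V \<omega>))\<^sup>2)"
      using norm_add_sq_le[of 1 "U _" "- V _"] by simp
  qed measurable
  then show ?thesis
    by (simp add: L2_def)
qed

lemma msq_nonneg: "0 \<le> msq M V"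
  by (simp add: msq_def)

text \<open>Young's inequality for the error \<open>U - W\<close> passing through an intermediate value \<open>V\<close>. With
  \<open>\<epsilon> = h\<close> the part to be propagated only grows by \<open>1 + h\<close> per step, at the price of the factor
  \<open>1 / h\<close> on the part that is created in the step.\<close>

lemma msq_triangle:
  fixes U V W :: "'w \<Rightarrow> 'e::euclidean_space"
  assumes "U \<in> L2 M M" "V \<in> L2 M M" "W \<in> L2 M M" and \<epsilon>: "0 < \<epsilon>"
  shows "msq M (\<lambda>\<omega>. U \<omega> - W \<omega>)
    \<le> (1 + \<epsilon>) * msq M (\<lambda>\<omega>. V \<omega> - W \<omega>) + (1 + 1 / \<epsilon>) * msq M (\<lambda>\<omega>. U \<omega> - V \<omega>)"
proof -
  have int: "integrable M (\<lambda>\<omega>. (norm (U \<omega> - W \<omega>))\<^sup>2)" "integrable M (\<lambda>\<omega>. (norm (V \<omega> - W \<omega>))\<^sup>2)"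
    "integrable M (\<lambda>\<omega>. (norm (U \<omega> - V \<omega>))\<^sup>2)"
    using assms L2_diff[of _ M] by (auto simp: L2_def)
  have "msq M (\<lambda>\<omega>. U \<omega> - W \<omega>)
      \<le> (LINT \<omega>|M. (1 + \<epsilon>) * (norm (V \<omega> - W \<omega>))\<^sup>2 + (1 + 1 / \<epsilon>) * (norm (U \<omega> - V \<omega>))\<^sup>2)"
    unfolding msq_def
  proof (rule integral_mono)
    fix \<omega>
    show "(norm (U \<omega> - W \<omega>))\<^sup>2
        \<le> (1 + \<epsilon>) * (norm (V \<omega> - W \<omega>))\<^sup>2 + (1 + 1 / \<epsilon>) * (norm (U \<omega> - V \<omega>))\<^sup>2"
      using norm_add_sq_le[OF \<epsilon>, of "V \<omega> - W \<omega>" "U \<omega> - V \<omega>"] by simp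
  qed (use int in auto)
  also have "\<dots> = (1 + \<epsilon>) * msq M (\<lambda>\<omega>. V \<omega> - W \<omega>) + (1 + 1 / \<epsilon>) * msq M (\<lambda>\<omega>. U \<omega> - V \<omega>)"
    unfolding msq_def using int by (subst Bochner_Integration.integral_add) auto
  finally show ?thesis .
qed

section \<open>A backward discrete Gronwall inequality\<close>

definition discounted_tail :: "real \<Rightarrow> (nat \<Rightarrow> real) \<Rightarrow> nat \<Rightarrow> nat \<Rightarrow> real" where
  "discounted_tail d \<eta> N k = (\<Sum>j=k..<N. d ^ (j - k) * \<eta> j)"

lemma discounted_tail_end: "discounted_tail d \<eta> N N = 0"
  by (simp add: discounted_tail_def)

lemma discounted_tail_rec:
  assumes "k < N"
  shows "discounted_tail d \<eta> N k = \<eta> k + d * discounted_tail d \<eta> N (Suc k)"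
proof -
  have "(\<Sum>j=Suc k..<N. d ^ (j - k) * \<eta> j) = (\<Sum>j=Suc k..<N. d * (d ^ (j - Suc k) * \<eta> j))"
  proof (intro sum.cong refl)
    fix j assume "j \<in> {Suc k..<N}"
    then have "j - k = Suc (j - Suc k)"
      by (simp add: Suc_diff_Suc)
    then show "d ^ (j - k) * \<eta> j = d * (d ^ (j - Suc k) * \<eta> j)"
      by (simp only: power_Suc mult.assoc)
  qed
  then show ?thesis
    using assms by (simp add: discounted_tail_def sum.atLeast_Suc_lessThan sum_distrib_left)
qed

text \<open>As the terms \<open>\<eta>\<close> have no sign, replacing their weights by larger powers of \<open>p * d\<close> would not give
  an upper bound. In the induction step the new tail sum needs the old one times \<open>d\<close>, but the
  recursion multiplies it by \<open>p * d\<close>. The excess \<open>p * (p - 1) * d\<close> times the old tail sum has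
  a nonnegative coefficient, so it is at most the same multiple of \<open>P\<close> and can be treated like \<open>\<theta>\<close>.\<close>

lemma backward_gronwall:
  fixes A \<zeta> \<theta> \<eta> :: "nat \<Rightarrow> real"
  assumes p: "1 \<le> p" and d: "1 \<le> d"
    and \<zeta>: "\<And>i. 0 \<le> \<zeta> i" and \<theta>: "\<And>i. 0 \<le> \<theta> i"
    and rec: "\<And>i. i < N \<Longrightarrow> A i + \<zeta> i \<le> p * d * A (Suc i) + p * \<eta> i + \<theta> i"
    and tail: "\<And>i. i \<le> N \<Longrightarrow> discounted_tail d \<eta> N i \<le> P" and P: "0 \<le> P"
    and "k \<le> N"
  shows "A k + (\<Sum>i=k..<N. \<zeta> i)
    \<le> (p * d) ^ (N - k) * (A N + (\<Sum>i=k..<N. \<theta> i + p * (p - 1) * d * P))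
      + p * discounted_tail d \<eta> N k"
  using \<open>k \<le> N\<close>
proof (induction rule: inc_induct)
  case base
  then show ?case
    by (simp add: discounted_tail_end)
next
  case (step k)
  define S where "S = discounted_tail d \<eta> N"
  define r where "r i = \<theta> i + p * (p - 1) * d * P" for i
  have q: "1 \<le> p * d"
    using p d by (metis mult_mono' mult_1 zero_le_one)
  have r: "0 \<le> r i" for i
    unfolding r_def using p d \<theta> P by simp
  have split: "(\<Sum>i=k..<N. u i) = u k + (\<Sum>i=Suc k..<N. u i)" for u :: "nat \<Rightarrow> real"
    using step.hyps by (simp add: sum.atLeast_Suc_lessThan)
  have "A k + (\<Sum>i=k..<N. \<zeta> i)
      \<le> p * d * A (Suc k) + p * \<eta> k + \<theta> k + (\<Sum>i=Suc k..<N. \<zeta> i)"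
    using rec[of k] step.hyps by (simp add: split)
  also have "\<dots> \<le> p * d * (A (Suc k) + (\<Sum>i=Suc k..<N. \<zeta> i)) + p * \<eta> k + \<theta> k"
    using mult_right_mono[OF q sum_nonneg[of "{Suc k..<N}" \<zeta>]] \<zeta> by (simp add: distrib_left)
  also have "\<dots> \<le> p * d * ((p * d) ^ (N - Suc k) * (A N + (\<Sum>i=Suc k..<N. r i)) + p * S (Suc k))
      + p * \<eta> k + \<theta> k"
    using step.IH q unfolding S_def r_def by (intro add_right_mono mult_left_mono) auto
  also have "\<dots> = (p * d) ^ (N - k) * (A N + (\<Sum>i=Suc k..<N. r i)) + p * (\<eta> k + d * S (Suc k))
      + (\<theta> k + p * (p - 1) * d * S (Suc k))"
  proof -
    have "N - k = Suc (N - Suc k)"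
      using step.hyps by simp
    then show ?thesis
      by (simp add: algebra_simps)
  qed
  also have "\<eta> k + d * S (Suc k) = S k"
    unfolding S_def using step.hyps by (simp add: discounted_tail_rec)
  also have "\<theta> k + p * (p - 1) * d * S (Suc k) \<le> r k"
    unfolding r_def S_def using tail[of "Suc k"] step.hyps p d
    by (intro add_left_mono mult_left_mono) auto
  also have "r k \<le> (p * d) ^ (N - k) * r k"
    using mult_right_mono[OF one_le_power[OF q] r] by simp
  finally show ?case
    unfolding S_def r_def[symmetric] split[of r] by (simp add: algebra_simps)
qed

text \<open>The deterministic core of the estimate, for errors \<open>a\<close>, \<open>z\<close>, one-step errors \<open>\<tau>y\<close>, \<open>\<tau>z\<close> and
  stability differences \<open>u\<close>, \<open>w\<close>. Passing from \<open>\<rho> * w\<close> to \<open>z\<close> by \<open>young_z\<close> loses a factor 2, which leaves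
  \<open>\<rho> / 2 * z\<close>; since stability charges only \<open>\<rho> / 4\<close> for the next \<open>Z\<close>-error, the recursion needs one half
  of it and the other half is available for the sum of the \<open>z\<close>.\<close>

lemma stable_recursion_bound:
  fixes a z u w \<tau>y \<tau>z \<eta> :: "nat \<Rightarrow> real"
  assumes pos: "0 < \<rho>" "0 < T" "0 < c" and N: "1 \<le> N"
  defines "h \<equiv> T / real N"
  defines "Q \<equiv> exp ((1 + c) * T)"
  defines "K\<^sub>0 \<equiv> Q * T * exp (c * T) + 1"
  assumes nonneg: "\<And>i. 0 \<le> a i" "\<And>i. 0 \<le> z i" "\<And>i. 0 \<le> u i" "\<And>i. 0 \<le> w i"
      "\<And>i. 0 \<le> \<tau>y i" "\<And>i. 0 \<le> \<tau>z i"
    and young_a: "\<And>i. i < N \<Longrightarrow> a i \<le> (1 + h) * u i + (1 + 1 / h) * \<tau>y i"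
    and young_z: "\<And>i. i < N \<Longrightarrow> z i * h \<le> 2 * (w i * h) + 2 * \<tau>z i"
    and stable: "\<And>i. i < N \<Longrightarrow>
      u i + \<rho> * w i * h \<le> (1 + c * h) * (a (Suc i) + \<rho> / 4 * z (Suc i) * h) + \<eta> i"
    and tail: "\<And>i. i < N \<Longrightarrow> discounted_tail (exp (c * h)) \<eta> N i \<le> R"
  shows "Max (a ` {0..N}) + (\<Sum>i=0..<N. z i * h)
    \<le> (1 + 4 / \<rho>) * (Q * (1 + T + \<rho>) + K\<^sub>0 * (1 + T) * ((1 + c * T) * (1 + \<rho>)))
        * (a N + z N * h + (\<Sum>i=0..<N. \<tau>y i / h + \<tau>z i))
      + (1 + 4 / \<rho>) * K\<^sub>0 * (1 + h) * R"
proof -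
  define A where "A i = a i + \<rho> / 4 * z i * h" for i
  define \<zeta> where "\<zeta> i = \<rho> / 4 * z i * h" for i
  define \<theta> where "\<theta> i = (1 + 1 / h) * \<tau>y i + \<rho> * \<tau>z i" for i
  define d where "d = exp (c * h)"
  define E where "E = a N + z N * h"
  define \<Theta> where "\<Theta> = (\<Sum>i=0..<N. \<tau>y i / h + \<tau>z i)"
  define P where "P = max 0 R"
  define D where "D = Q * (1 + T + \<rho>) * (E + \<Theta>) + K\<^sub>0 * (1 + h) * P"
  have h: "0 < h" "h \<le> T" "real N * h = T"
    using pos N by (auto simp: h_def field_simps)
  have d: "1 \<le> d" "1 + c * h \<le> d" "d \<le> exp (c * T)"
    using pos h exp_ge_add_one_self[of "c * h"] by (auto simp: d_def)
  have A0: "0 \<le> A i" and \<zeta>0: "0 \<le> \<zeta> i" and \<theta>0: "0 \<le> \<theta> i" for i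
    using nonneg pos h by (auto simp: A_def \<zeta>_def \<theta>_def)
  have E0: "0 \<le> E" and \<Theta>0: "0 \<le> \<Theta>"
    using nonneg h by (auto simp: E_def \<Theta>_def intro!: sum_nonneg)
  have K0: "0 < K\<^sub>0" and Q0: "0 < Q"
    using pos by (auto simp: K\<^sub>0_def Q_def add_pos_pos)
  have AE: "A N \<le> (1 + \<rho>) * E"
    using nonneg(1,2)[of N] pos h unfolding A_def E_def by (simp add: algebra_simps)

  \<comment> \<open>The factor \<open>1 + c * h\<close> is enlarged to \<open>exp (c * h)\<close>, the ratio of the tail sums; otherwise the
    mismatch of rates could have a negative coefficient when \<open>h\<close> is large.\<close>
  have step: "A i + \<zeta> i \<le> (1 + h) * d * A (Suc i) + (1 + h) * \<eta> i + \<theta> i" if "i < N" for i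
  proof -
    have "A i + \<zeta> i = a i + \<rho> / 2 * (z i * h)"
      by (simp add: A_def \<zeta>_def)
    also have "\<dots> \<le> (1 + h) * u i + (1 + 1 / h) * \<tau>y i + \<rho> / 2 * (2 * (w i * h) + 2 * \<tau>z i)"
      using young_a[OF that] young_z[OF that] pos by (intro add_mono mult_left_mono) auto
    also have "\<dots> = (1 + h) * u i + 1 * (\<rho> * w i * h) + \<theta> i"
      by (simp add: \<theta>_def algebra_simps)
    also have "\<dots> \<le> (1 + h) * u i + (1 + h) * (\<rho> * w i * h) + \<theta> i"
      using nonneg h pos by (intro add_left_mono add_right_mono mult_right_mono) auto
    also have "\<dots> = (1 + h) * (u i + \<rho> * w i * h) + \<theta> i"
      by (simp add: algebra_simps)
    also have "\<dots> \<le> (1 + h) * ((1 + c * h) * A (Suc i) + \<eta> i) + \<theta> i"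
      using stable[OF that] h unfolding A_def by (intro add_right_mono mult_left_mono) auto
    also have "\<dots> \<le> (1 + h) * (d * A (Suc i) + \<eta> i) + \<theta> i"
      using d h A0 by (intro add_right_mono mult_left_mono mult_right_mono) auto
    finally show ?thesis
      by (simp add: algebra_simps)
  qed
  have tailP: "discounted_tail d \<eta> N i \<le> P" if "i \<le> N" for i
    using that tail[of i] by (cases "i = N") (auto simp: discounted_tail_end P_def d_def)
  have P0: "0 \<le> P"
    by (simp add: P_def)

  have growth: "((1 + h) * d) ^ n \<le> Q" if "n \<le> N" for n
  proof -
    have "((1 + h) * d) ^ n \<le> (exp h * d) ^ n"
      using h d exp_ge_add_one_self[of h] by (intro power_mono mult_right_mono) auto
    also have "\<dots> = exp (real n * ((1 + c) * h))"
      by (simp add: d_def exp_add[symmetric] exp_of_nat_mult[symmetric] algebra_simps)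
    also have "\<dots> \<le> exp (real N * ((1 + c) * h))"
      using that pos h by (simp add: mult_right_mono)
    also have "real N * ((1 + c) * h) = (1 + c) * T"
      using h(3) by (metis mult.left_commute)
    finally show ?thesis
      by (simp add: Q_def)
  qed
  have \<theta>_le: "\<theta> i \<le> (1 + T + \<rho>) * (\<tau>y i / h + \<tau>z i)" for i
  proof -
    have "\<theta> i = (1 + h) * (\<tau>y i / h) + \<rho> * \<tau>z i"
      using h by (simp add: \<theta>_def field_simps)
    also have "\<dots> \<le> (1 + T + \<rho>) * (\<tau>y i / h) + (1 + T + \<rho>) * \<tau>z i"
    proof (rule add_mono)
      show "(1 + h) * (\<tau>y i / h) \<le> (1 + T + \<rho>) * (\<tau>y i / h)"
        using h pos nonneg by (intro mult_right_mono) auto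
      show "\<rho> * \<tau>z i \<le> (1 + T + \<rho>) * \<tau>z i"
        using pos nonneg by (intro mult_right_mono) auto
    qed
    finally show ?thesis
      by (simp add: distrib_left)
  qed
  have main: "A k + (\<Sum>i=k..<N. \<zeta> i) \<le> D" if k: "k \<le> N" for k
  proof -
    define r where "r i = \<theta> i + (1 + h) * h * d * P" for i
    have r0: "0 \<le> r i" for i
      using \<theta>0 h d P0 by (simp add: r_def)
    have "A k + (\<Sum>i=k..<N. \<zeta> i)
      \<le> ((1 + h) * d) ^ (N - k) * (A N + (\<Sum>i=k..<N. r i)) + (1 + h) * discounted_tail d \<eta> N k"
      using backward_gronwall[where p = "1 + h" and A = A and \<theta> = \<theta>] h d A0 \<zeta>0 \<theta>0 step tailP P0 k
      by (simp add: r_def)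
    also have "\<dots> \<le> Q * (A N + (\<Sum>i=0..<N. r i)) + (1 + h) * P"
    proof (rule add_mono)
      have "(\<Sum>i=k..<N. r i) \<le> (\<Sum>i=0..<N. r i)"
        using r0 by (intro sum_mono2) auto
      moreover have "0 \<le> (\<Sum>i=k..<N. r i)"
        using r0 by (simp add: sum_nonneg)
      ultimately show "((1 + h) * d) ^ (N - k) * (A N + (\<Sum>i=k..<N. r i))
          \<le> Q * (A N + (\<Sum>i=0..<N. r i))"
        using growth[of "N - k"] A0[of N] Q0 by (intro mult_mono) auto
      show "(1 + h) * discounted_tail d \<eta> N k \<le> (1 + h) * P"
        using tailP[OF k] h by (intro mult_left_mono) auto
    qed
    also have "(\<Sum>i=0..<N. r i) = (\<Sum>i=0..<N. \<theta> i) + (real N * h) * ((1 + h) * d * P)"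
      by (simp add: r_def sum.distrib)
    also have "\<dots> \<le> (1 + T + \<rho>) * \<Theta> + T * ((1 + h) * exp (c * T) * P)"
      unfolding \<Theta>_def sum_distrib_left h(3) using \<theta>_le d h P0 pos
      by (intro add_mono sum_mono mult_left_mono mult_right_mono) auto
    also have "A N \<le> (1 + T + \<rho>) * E"
      using AE mult_right_mono[OF _ E0, of "1 + \<rho>" "1 + T + \<rho>"] pos by simp
    finally have "A k + (\<Sum>i=k..<N. \<zeta> i) \<le> Q * ((1 + T + \<rho>) * E
        + ((1 + T + \<rho>) * \<Theta> + T * ((1 + h) * exp (c * T) * P))) + (1 + h) * P"
      using Q0 by simp
    then show ?thesis
      by (simp add: D_def K\<^sub>0_def algebra_simps)
  qed

  have "Max (a ` {0..N}) \<le> D"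
  proof (rule Max.boundedI)
    fix y assume "y \<in> a ` {0..N}"
    then obtain k where k: "k \<le> N" "y = a k"
      by auto
    have "a k \<le> A k" "0 \<le> (\<Sum>i=k..<N. \<zeta> i)"
      using nonneg pos h \<zeta>0 by (auto simp: A_def intro: sum_nonneg)
    then show "y \<le> D"
      using main[OF k(1)] k(2) by simp
  qed auto
  moreover have "(\<Sum>i=0..<N. z i * h) \<le> 4 / \<rho> * D"
  proof -
    have "(\<Sum>i=0..<N. \<zeta> i) \<le> D"
      using main[of 0] A0[of 0] by simp
    moreover have "(\<Sum>i=0..<N. \<zeta> i) = \<rho> / 4 * (\<Sum>i=0..<N. z i * h)"
      by (simp add: \<zeta>_def sum_distrib_left algebra_simps)
    ultimately show ?thesis
      using pos by (simp add: field_simps)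
  qed
  ultimately have bound: "Max (a ` {0..N}) + (\<Sum>i=0..<N. z i * h) \<le> (1 + 4 / \<rho>) * D"
    unfolding distrib_right mult_1 by (rule add_mono)

  \<comment> \<open>The negative part of \<open>R\<close> is at most the negative part of the last tail sum \<open>\<eta> (N - 1)\<close>.\<close>
  have P_le: "P \<le> R + (1 + c * T) * (1 + \<rho>) * (E + \<Theta>)"
  proof -
    have "- \<eta> (N - 1) \<le> (1 + c * h) * A N"
    proof -
      have "0 \<le> u (N - 1) + \<rho> * w (N - 1) * h"
        using nonneg pos h by simp
      also have "\<dots> \<le> (1 + c * h) * A N + \<eta> (N - 1)"
        using stable[of "N - 1"] N by (simp add: A_def)
      finally show ?thesis
        by simp
    qed
    also have "\<dots> \<le> (1 + c * T) * ((1 + \<rho>) * E)"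
      using AE A0 h pos by (intro mult_mono) auto
    also have "\<dots> \<le> (1 + c * T) * ((1 + \<rho>) * (E + \<Theta>))"
      using pos \<Theta>0 by (intro mult_left_mono) auto
    finally have "- \<eta> (N - 1) \<le> (1 + c * T) * (1 + \<rho>) * (E + \<Theta>)"
      by (simp add: mult.assoc)
    moreover have "\<eta> (N - 1) \<le> R"
      using tail[of "N - 1"] N by (simp add: discounted_tail_rec discounted_tail_end)
    moreover have "0 \<le> (1 + c * T) * (1 + \<rho>) * (E + \<Theta>)"
      using pos E0 \<Theta>0 by simp
    ultimately show ?thesis
      by (simp add: P_def)
  qed
  have "D \<le> Q * (1 + T + \<rho>) * (E + \<Theta>)
      + K\<^sub>0 * (1 + h) * (R + (1 + c * T) * (1 + \<rho>) * (E + \<Theta>))"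
    unfolding D_def using P_le K0 h by (intro add_left_mono mult_left_mono) auto
  also have "\<dots> = Q * (1 + T + \<rho>) * (E + \<Theta>)
      + K\<^sub>0 * (1 + h) * ((1 + c * T) * (1 + \<rho>) * (E + \<Theta>)) + K\<^sub>0 * (1 + h) * R"
    by (simp add: algebra_simps)
  also have "\<dots> \<le> Q * (1 + T + \<rho>) * (E + \<Theta>)
      + K\<^sub>0 * (1 + T) * ((1 + c * T) * (1 + \<rho>) * (E + \<Theta>)) + K\<^sub>0 * (1 + h) * R"
    using K0 h pos E0 \<Theta>0 by (intro add_left_mono add_right_mono mult_right_mono mult_left_mono) auto
  also have "\<dots> = (Q * (1 + T + \<rho>) + K\<^sub>0 * (1 + T) * ((1 + c * T) * (1 + \<rho>))) * (E + \<Theta>)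
      + K\<^sub>0 * (1 + h) * R"
    by (simp add: algebra_simps)
  finally have "(1 + 4 / \<rho>) * D \<le> (1 + 4 / \<rho>) *
      ((Q * (1 + T + \<rho>) + K\<^sub>0 * (1 + T) * ((1 + c * T) * (1 + \<rho>))) * (E + \<Theta>) + K\<^sub>0 * (1 + h) * R)"
    using pos by (intro mult_left_mono) auto
  also have "\<dots> = (1 + 4 / \<rho>) * (Q * (1 + T + \<rho>) + K\<^sub>0 * (1 + T) * ((1 + c * T) * (1 + \<rho>)))
        * (E + \<Theta>) + (1 + 4 / \<rho>) * K\<^sub>0 * (1 + h) * R"
    by (subst distrib_left) (simp only: mult.assoc)
  finally show ?thesis
    using bound unfolding E_def \<Theta>_def by linarith
qed

section \<open>Square integrability of the exact solution and of the scheme\<close>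

lemma subalgebra_sigma:
  assumes "A \<subseteq> sets M"
  shows "subalgebra M (sigma (space M) A)"
proof -
  have "A \<subseteq> Pow (space M)"
    using assms sets.space_closed by blast
  then show ?thesis
    using assms by (auto simp: subalgebra_def sets.sigma_sets_subset)
qed

lemma L2_subalgebra: "subalgebra M G \<Longrightarrow> V \<in> L2 M G \<Longrightarrow> V \<in> L2 M M"
  by (auto simp: L2_def intro: measurable_from_subalg)

lemma subalgebra_aug_filtration:
  assumes "brownian_motion M T W" "t \<in> {0..T}"
  shows "subalgebra M (aug_filtration M W t)"
  unfolding aug_filtration_def
proof (rule subalgebra_sigma)
  show "(\<Union>s\<in>{0..t}. {W s -` A \<inter> space M |A. A \<in> sets borel}) \<union> null_sets M \<subseteq> sets M"
    using assms by (auto simp: brownian_motion_def intro!: measurable_sets)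
qed

text \<open>The value at time \<open>t\<close> is the section at \<open>t\<close> of the jointly measurable map on \<open>{0..t}\<close>.\<close>

lemma progressive_measurable:
  assumes "progressive M F T U" "t \<in> {0..T}"
  shows "U t \<in> borel_measurable (F t)"
proof -
  have "t \<in> space (restrict_space borel {0..t})"
    using assms(2) by (simp add: space_restrict_space)
  then have pair: "Pair t \<in> F t \<rightarrow>\<^sub>M restrict_space borel {0..t} \<Otimes>\<^sub>M F t"
    by (rule measurable_Pair1')
  have "(\<lambda>(s, \<omega>). U s \<omega>) \<in> borel_measurable (restrict_space borel {0..t} \<Otimes>\<^sub>M F t)"
    using assms by (auto simp: progressive_def)
  from measurable_compose[OF pair this] show ?thesis
    by simp
qed

context fbsde
begin

lemma Y_L2:
  assumes t: "t \<in> {0..T}"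
  shows "Y t \<in> L2 M (aug_filtration M W t)"
proof -
  have meas: "Y t \<in> borel_measurable (aug_filtration M W t)"
    using Y_S2 t by (auto simp: S2_def intro: progressive_measurable)
  obtain B :: "'w \<Rightarrow> real" where B: "integrable M B" "AE \<omega> in M. \<forall>t\<in>{0..T}. (norm (Y t \<omega>))\<^sup>2 \<le> B \<omega>"
    using Y_S2 by (auto simp: S2_def)
  have [measurable]: "Y t \<in> borel_measurable M"
    using measurable_from_subalg[OF subalgebra_aug_filtration[OF brownian t] meas] .
  have "integrable M (\<lambda>\<omega>. (norm (Y t \<omega>))\<^sup>2)"
  proof (rule Bochner_Integration.integrable_bound[OF B(1)])
    show "AE \<omega> in M. norm ((norm (Y t \<omega>))\<^sup>2) \<le> norm (B \<omega>)"
      using B(2) by eventually_elim (use t in fastforce)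
  qed measurable
  then show ?thesis
    using meas by (simp add: L2_def)
qed

text \<open>At the last grid point \<open>Zbar\<close> is \<open>Z T\<close> itself, which is adapted because \<open>Z\<close> is progressive; at the
  earlier ones it is a conditional expectation.\<close>

lemma Zbar_adapted:
  assumes N: "1 \<le> N" and i: "i \<le> N"
  shows "Zbar M (aug_filtration M W) T Z N i \<in> L2 M (aug_filtration M W (real i * (T / real N)))"
proof -
  have "Zbar M (aug_filtration M W) T Z N i \<in> borel_measurable (aug_filtration M W (real i * (T / real N)))"
  proof (cases "i < N")
    case True
    then show ?thesis
      by (subst borel_measurable_euclidean_space)
        (auto simp: Zbar_def Let_def Basis_vec_def inner_axis)
  next
    case False
    then have "real i * (T / real N) = T"
      using N i by simp
    moreover have "Z T \<in> borel_measurable (aug_filtration M W T)"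
      using Z_H2 T_pos by (auto simp: H2_def intro: progressive_measurable)
    ultimately show ?thesis
      using False by (simp add: Zbar_def Let_def)
  qed
  then show ?thesis
    using Zbar_L2[OF N i] by (simp add: L2_def)
qed

end

context backward_scheme
begin

lemma subalgebra_grid_filtration:
  assumes "1 \<le> N" "i \<le> N"
  shows "subalgebra M (grid_filtration M Xg N i)"
  unfolding grid_filtration_def
proof (rule subalgebra_sigma)
  show "(\<Union>j\<in>{..i}. {Xg N j -` A \<inter> space M |A. A \<in> sets borel}) \<subseteq> sets M"
    using assms grid_measurable[of N] by (auto intro!: measurable_sets)
qed

lemma scheme_adapted:
  assumes N: "1 \<le> N" and "i \<le> N"
  shows "(Yh N i, Zh N i) \<in> L2 M (grid_filtration M Xg N i) \<times> L2 M (grid_filtration M Xg N i)"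
  using \<open>i \<le> N\<close>
proof (induction rule: inc_induct)
  case base
  then show ?case
    using terminal[OF N] .
next
  case (step i)
  then show ?case
    using op_grid[OF N, of i] recursion[OF N, of i] by simp
qed

lemma scheme_L2:
  assumes "1 \<le> N" "i \<le> N"
  shows "Yh N i \<in> L2 M M" "Zh N i \<in> L2 M M"
  using scheme_adapted[OF assms] L2_subalgebra[OF subalgebra_grid_filtration[OF assms]] by auto

end

theorem lemma4p6:
  fixes \<rho> T c :: real
  assumes "0 < \<rho>" and "0 < T" and "0 < c"
  shows "\<exists>C>0. \<exists>K>0.
    \<forall>(M :: 'w measure) (W :: real \<Rightarrow> 'w \<Rightarrow> real^'d)
     (b :: real \<Rightarrow> real^'n \<Rightarrow> real^'n) (\<sigma> :: real \<Rightarrow> real^'n \<Rightarrow> real^'d^'n)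
     (f :: real \<Rightarrow> real^'n \<Rightarrow> real^'k \<Rightarrow> real^'d^'k \<Rightarrow> real^'k) (g :: real^'n \<Rightarrow> real^'k) x X Y Z
     (Xg :: nat \<Rightarrow> nat \<Rightarrow> 'w \<Rightarrow> real^'n) \<Phi> Yh Zh H.
      fbsde M T W b \<sigma> f g x X Y Z \<longrightarrow>
      backward_scheme M T (aug_filtration M W) Xg \<Phi> Yh Zh \<longrightarrow>
      stable_scheme M (aug_filtration M W) T Y Z Xg \<Phi> Yh Zh \<rho> c H \<longrightarrow>
      (\<forall>N\<ge>1. let h = T / real N; F = aug_filtration M W in
        Max (err_Y M T Y Yh N ` {0..N}) + (\<Sum>i=0..<N. err_Z M F T Z Zh N i * h)
        \<le> C * (err_Y M T Y Yh N N + err_Z M F T Z Zh N N * h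
                + (\<Sum>i=0..<N. tau_Y M F T Y Z \<Phi> N i / h + tau_Z M F T Y Z \<Phi> N i))
          + K * (1 + h) * stability_remainder M T c H N)"
proof -
  define Q where "Q = exp ((1 + c) * T)"
  define K\<^sub>0 where "K\<^sub>0 = Q * T * exp (c * T) + 1"
  define C where "C = (1 + 4 / \<rho>) * (Q * (1 + T + \<rho>) + K\<^sub>0 * (1 + T) * ((1 + c * T) * (1 + \<rho>)))"
  define K where "K = (1 + 4 / \<rho>) * K\<^sub>0"
  have QK: "0 < Q" "0 < K\<^sub>0"
    using assms by (auto simp: Q_def K\<^sub>0_def add_pos_pos)
  have CK: "0 < C" "0 < K"
    unfolding C_def K_def using QK assms by (auto intro!: mult_pos_pos add_pos_pos)
  have bound: "Max (err_Y M T Y Yh N ` {0..N}) + (\<Sum>i=0..<N. err_Z M F T Z Zh N i * h)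
        \<le> C * (err_Y M T Y Yh N N + err_Z M F T Z Zh N N * h
                + (\<Sum>i=0..<N. tau_Y M F T Y Z \<Phi> N i / h + tau_Z M F T Y Z \<Phi> N i))
          + K * (1 + h) * stability_remainder M T c H N"
    if fbsde: "fbsde M T W b \<sigma> f g x X Y Z"
      and scheme: "backward_scheme M T (aug_filtration M W) Xg \<Phi> Yh Zh"
      and stable: "stable_scheme M (aug_filtration M W) T Y Z Xg \<Phi> Yh Zh \<rho> c H"
      and N: "1 \<le> N" and h: "h = T / real N" and F: "F = aug_filtration M W"
    for M :: "'w measure" and W :: "real \<Rightarrow> 'w \<Rightarrow> real^'d" and b \<sigma> f g and x :: "real^'n" and X
      and Y :: "real \<Rightarrow> 'w \<Rightarrow> real^'k" and Z :: "real \<Rightarrow> 'w \<Rightarrow> real^'d^'k"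
      and Xg :: "nat \<Rightarrow> nat \<Rightarrow> 'w \<Rightarrow> real^'n" and \<Phi> Yh Zh H h F and N :: nat
  proof -
    interpret fbsde M T W b \<sigma> f g x X Y Z
      by (fact fbsde)
    interpret backward_scheme M T F Xg \<Phi> Yh Zh
      unfolding F by (fact scheme)
    define u where "u i = msq M (\<lambda>\<omega>. fst (exact_step M F T Y Z \<Phi> N i) \<omega> - Yh N i \<omega>)" for i
    define w where "w i = msq M (\<lambda>\<omega>. snd (exact_step M F T Y Z \<Phi> N i) \<omega> - Zh N i \<omega>)" for i
    define \<eta> where "\<eta> j = (LINT \<omega>|M. H N j \<omega>)" for j
    have h0: "0 < h"
      using N \<open>0 < T\<close> by (simp add: h)
    have grid: "real i * h \<in> {0..T}" if "i \<le> N" for i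
      using that N \<open>0 < T\<close> by (auto simp: h field_simps)
    have F_sub: "subalgebra M (F (real i * h))" if "i \<le> N" for i
      unfolding F using subalgebra_aug_filtration[OF brownian grid[OF that]] .
    have exact_adapted: "Y (real i * h) \<in> L2 M (F (real i * h))"
        "Zbar M F T Z N i \<in> L2 M (F (real i * h))" if "i \<le> N" for i
      using Y_L2[OF grid[OF that]] Zbar_adapted[OF N that] by (simp_all add: F h)
    have exact_L2: "Y (real i * h) \<in> L2 M M" "Zbar M F T Z N i \<in> L2 M M" if "i \<le> N" for i
      using L2_subalgebra[OF F_sub[OF that]] exact_adapted[OF that] by auto
    have step_L2: "fst (exact_step M F T Y Z \<Phi> N i) \<in> L2 M M"
        "snd (exact_step M F T Y Z \<Phi> N i) \<in> L2 M M" if "i < N" for i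
    proof -
      have "exact_step M F T Y Z \<Phi> N i \<in> L2 M M \<times> L2 M M"
        unfolding exact_step_def using op_full[OF N that] exact_adapted[of "Suc i"] that
        by (simp add: h del: of_nat_Suc)
      then show "fst (exact_step M F T Y Z \<Phi> N i) \<in> L2 M M"
          "snd (exact_step M F T Y Z \<Phi> N i) \<in> L2 M M"
        by auto
    qed
    show ?thesis
      unfolding C_def K_def K\<^sub>0_def Q_def h
    proof (rule stable_recursion_bound[where u = u and w = w and \<eta> = \<eta>])
      fix i assume i: "i < N"
      then have "i \<le> N"
        by simp
      show "err_Y M T Y Yh N i \<le> (1 + T / real N) * u i + (1 + 1 / (T / real N)) * tau_Y M F T Y Z \<Phi> N i"
        unfolding err_Y_def tau_Y_def u_def h[symmetric]
        by (intro msq_triangle exact_L2 step_L2 scheme_L2 h0 N i \<open>i \<le> N\<close>)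
      have "err_Z M F T Z Zh N i
          \<le> (1 + 1) * w i + (1 + 1 / 1) * msq M (\<lambda>\<omega>. Zbar M F T Z N i \<omega> - snd (exact_step M F T Y Z \<Phi> N i) \<omega>)"
        unfolding err_Z_def w_def
        by (intro msq_triangle exact_L2 step_L2 scheme_L2 N i \<open>i \<le> N\<close> zero_less_one)
      from mult_right_mono[OF this less_imp_le[OF h0]]
      show "err_Z M F T Z Zh N i * (T / real N) \<le> 2 * (w i * (T / real N)) + 2 * tau_Z M F T Y Z \<Phi> N i"
        unfolding tau_Z_def h[symmetric] by (simp add: algebra_simps)
      have eq: "\<Phi> N i (Yh N (Suc i), Zh N (Suc i)) = (Yh N i, Zh N i)"
        using recursion[OF N i] by simp
      show "u i + \<rho> * w i * (T / real N) \<le> (1 + c * (T / real N)) *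
          (err_Y M T Y Yh N (Suc i) + \<rho> / 4 * err_Z M F T Z Zh N (Suc i) * (T / real N)) + \<eta> i"
        using stable[unfolded stable_scheme_def F[symmetric], THEN conjunct1, rule_format, OF N i]
        unfolding u_def w_def \<eta>_def eq by simp
      have "discounted_tail (exp (c * (T / real N))) \<eta> N i
          = (\<Sum>j=i..<N. exp (c * real (j - i) * (T / real N)) * (LINT \<omega>|M. H N j \<omega>))"
        unfolding discounted_tail_def \<eta>_def
        by (intro sum.cong refl) (simp add: exp_of_nat_mult[symmetric] mult_ac)
      then show "discounted_tail (exp (c * (T / real N))) \<eta> N i \<le> stability_remainder M T c H N"
        unfolding stability_remainder_def using i by (intro Max_ge) auto
    qed (use assms N h0 in \<open>auto simp: u_def w_def err_Y_def err_Z_def tau_Y_def tau_Z_def msq_nonneg\<close>)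
  qed
  show ?thesis
    unfolding Let_def
    by (intro exI[of _ C] exI[of _ K] conjI CK allI impI) (rule bound[OF _ _ _ _ refl refl])
qed

end
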